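(* For every initial condition $(\mathbf{x}(0),\dot{\mathbf{x}}(0))$, the optimal value $s_L^*$ of the lower bound problem and the optimal value $s^*$ of the jobshop scheduling problem (both defined in the context for that initial condition) satisfy $s_L^* \leq s^*$.
   Context: **Vehicles.** There are $n$ vehicles. Vehicle $j\in\{1,\ldots,n\}$ has position $x_j\in X_j\subseteq\mathbb{R}$ along its predefined longitudinal path and speed $\dot{x}_j\in\dot{X}_j=[\dot{x}_{j,min},\dot{x}_{j,max}]\subset\mathbb{R}$ with $\dot{x}_{j,min}>0$, and dynamics $\ddot{x}_j=f_j(x_j,\dot{x}_j,u_j)$ with input $u_j\in U_j=[u_{j,min},u_{j,max}]\subset\mathbb{R}$. Input signals $u_j(\cdot):t\mapsto u_j(t)\in U_j$ lie in a signal space $\mathcal{U}_j$. $x_j(t,u_j(\cdot),x_j(0),\dot{x}_j(0))$ and $\dot{x}_j(t,u_j(\cdot),x_j(0),\dot{x}_j(0))$ are the position and speed at time $t$ starting from $(x_j(0),\dot{x}_j(0))$ under $u_j(\cdot)$. Boldface denotes the aggregate over $j$: $\mathbf{x}=(x_1,\ldots,x_n)\in\mathbf{X}$, $\dot{\mathbf{x}}\in\dot{\mathbf{X}}$, $\mathbf{u}\in\mathbf{U}$, $\mathbf{u}(\cdot)\in\mathcal{U}$. Assumption 1: for all $j$, $x_j(t,u_j(\cdot),x_j(0),\dot{x}_j(0))$ depends continuously on $u_j(\cdot)\in\mathcal{U}_j$, and $\mathcal{U}_j$ is path-connected. Assumption 2 (monotonicity): write $u_j(\cdot)\le u_j'(\cdot)$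 if $u_j(t)\le u_j'(t)$ for all $t\ge0$. For all $j$, if $u_j(\cdot)\le u'_j(\cdot)$, $x_j(0)\le x'_j(0)$, $\dot{x}_j(0)\le\dot{x}'_j(0)$ and $0\le t\le t'$, then $x_j(t,u_j(\cdot),x_j(0),\dot{x}_j(0))\le x_j(t',u'_j(\cdot),x'_j(0),\dot{x}'_j(0))$. **Intersection and operations.** The intersection is a collection of $m$ conflict areas; conflict area $i$ occupies the open interval $(\alpha_{ij},\beta_{ij})\subset\mathbb{R}$ on the path of vehicle $j$ (if it lies on that path). $\bar{\mathcal{N}}$ is the set of operations $(i,j)\in\{1,\ldots,m\}\times\{1,\ldots,n\}$ such that conflict area $i$ is on the route of vehicle $j$. Given $\mathbf{x}(0)$, $\mathcal{N}=\{(i,j)\in\bar{\mathcal{N}}: x_j(0)<\beta_{ij}\}$. $\mathcal{F}\subseteq\mathcal{N}$ (resp. $\mathcal{L}\subseteq\mathcal{N}$) is the set of operations $(i,j)\in\mathcal{N}$ that are the first (resp. last) operation of vehicle $j$ in $\mathcal{N}$. The conjunctive arcs $\mathcal{C}$ are the arcs $(i,j)\to(i',j)$ between operations in $\mathcal{N}$ such that vehicle $j$ crosses conflict area $i$ and then, next, conflict area $i'$ (so $\beta_{ij}\le\alpha_{i'j}$). The disjunctive arcs $\mathcal{D}$ are the arcs $(i,j)\leftrightarrow(i,j')$ between operations in $\mathcal{N}$ with $j\ne j'$ (vehicles $j$ and $j'$ share conflict area $i$). **Jobshop scheduling problem.** A schedule is $\mathbf{T}=\{T_{ij}:(i,j)\in\mathcal{N}\}$,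 where $T_{ij}$ is the time at which vehicle $j$ enters conflict area $i$, i.e. $x_j(T_{ij},u_j(\cdot),x_j(0),\dot{x}_j(0))=\alpha_{ij}$ for some $u_j(\cdot)\in\mathcal{U}_j$ (when $x_j(0)<\alpha_{ij}$). Abbreviate $x_j(t,u_j(\cdot))=x_j(t,u_j(\cdot),x_j(0),\dot{x}_j(0))$. - Release time and deadline, for $(i,j)\in\mathcal{N}\setminus\mathcal{F}$ with $(i',j)\to(i,j)\in\mathcal{C}$: $R_{ij}(\mathbf{T})$ (resp. $D_{ij}(\mathbf{T})$) is the minimum (resp. maximum) over $u_j(\cdot)\in\mathcal{U}_j$ satisfying $x_j(T_{i'j},u_j(\cdot))=\alpha_{i'j}$ of the time $t$ with $x_j(t,u_j(\cdot))=\alpha_{ij}$; if the constraint cannot be satisfied, $R_{ij}=\infty$, $D_{ij}=-\infty$. For $(i,j)\in\mathcal{F}$: if $x_j(0)<\alpha_{ij}$, $R_{ij}$ (resp. $D_{ij}$) is the minimum (resp. maximum) over $u_j(\cdot)\in\mathcal{U}_j$ of the time $t$ with $x_j(t,u_j(\cdot))=\alpha_{ij}$; if $\alpha_{ij}\le x_j(0)$, $R_{ij}=D_{ij}=0$. - Process time: $P_{ij}(\mathbf{T})$ is the minimum over $u_j(\cdot)\in\mathcal{U}_j$ of the time $t$ with $x_j(t,u_j(\cdot))=\beta_{ij}$, subject to the following constraints: for $(i,j)\in\mathcal{N}\setminus\mathcal{L}$ with $(i,j)\to(i'',j)\in\mathcal{C}$, both $x_j(T_{ij},u_j(\cdot))=\alpha_{ij}$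 and $x_j(T_{i''j},u_j(\cdot))=\alpha_{i''j}$ if $x_j(0)<\alpha_{ij}$, and only $x_j(T_{i''j},u_j(\cdot))=\alpha_{i''j}$ if $\alpha_{ij}\le x_j(0)<\beta_{ij}$; for $(i,j)\in\mathcal{L}$, only $x_j(T_{ij},u_j(\cdot))=\alpha_{ij}$ if $x_j(0)<\alpha_{ij}$, and no constraint if $\alpha_{ij}\le x_j(0)<\beta_{ij}$. If the constraints cannot be satisfied, $P_{ij}=\infty$. Then $$s^*=\min_{\mathbf{T},\mathbf{k}}\ \max_{(i,j)\in\mathcal{N}}\big(T_{ij}-D_{ij}(\mathbf{T}),0\big)$$ subject to: $R_{ij}(\mathbf{T})\le T_{ij}$ for all $(i,j)\in\mathcal{N}$; and for all $(i,j)\leftrightarrow(i,j')\in\mathcal{D}$: $P_{ij}(\mathbf{T})\le T_{ij'}+M(1-k_{ijj'})$, $P_{ij'}(\mathbf{T})\le T_{ij}+M(1-k_{ij'j})$, $k_{ijj'}+k_{ij'j}=1$. Here $\mathbf{k}$ is the collection of $k_{ijj'}\in\{0,1\}$ and $M>0$ is a large number (big-M constant). (For all problems here, an infeasible problem has value $+\infty$.) **Lower bound problem.** Decision variables: real numbers $\mathbf{t}=\{t_{ij}\}$, $\mathbf{p}=\{p_{ij}\}$, $(i,j)\in\mathcal{N}$, and $\mathbf{k}=\{k_{ijj'}\in\{0,1\}\}$ for $(i,j)\leftrightarrow(i,j')\in\mathcal{D}$. ($p_{ij}\ge0$ plays the role of the time at which vehicle $j$ exits conflict area $i$ under the first-order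 dynamics $\dot{\chi}_j=v_j$, $v_j\in[\dot{x}_{j,min},\dot{x}_{j,max}]$, $\chi_j(0)=x_j(0)$.) For $(i,j)\in\mathcal{F}$: if $x_j(0)<\alpha_{ij}$, $r_{ij}$ (resp. $d_{ij}$) is the minimum (resp. maximum) over $u_j(\cdot)\in\mathcal{U}_j$ of the time $t$ with $x_j(t,u_j(\cdot),x_j(0),\dot{x}_j(0))=\alpha_{ij}$; if $\alpha_{ij}\le x_j(0)$, $r_{ij}=d_{ij}=0$. For $(i,j)\in\mathcal{N}\setminus\mathcal{F}$ with $(i',j)\to(i,j)\in\mathcal{C}$: $r_{ij}=p_{i'j}+\frac{\alpha_{ij}-\beta_{i'j}}{\dot{x}_{j,max}}$ and $d_{ij}=p_{i'j}+\frac{\alpha_{ij}-\beta_{i'j}}{\dot{x}_{j,min}}$. Then $$s_L^*=\min_{\mathbf{t},\mathbf{p},\mathbf{k}}\ \max_{(i,j)\in\mathcal{N}}(t_{ij}-d_{ij},0)$$ subject to: $r_{ij}\le t_{ij}$ and $\frac{\beta_{ij}-\alpha_{ij}}{\dot{x}_{j,max}}\le p_{ij}-t_{ij}\le\frac{\beta_{ij}-\alpha_{ij}}{\dot{x}_{j,min}}$ for all $(i,j)\in\mathcal{N}$; and for all $(i,j)\leftrightarrow(i,j')\in\mathcal{D}$: $p_{ij}\le t_{ij'}+M(1-k_{ijj'})$, $p_{ij'}\le t_{ij}+M(1-k_{ij'j})$, $k_{ijj'}+k_{ij'j}=1$.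
   Formalization: The claim fails for some initial conditions as printed; the theorem adds that no vehicle starts inside (or at the entry of) the last conflict area on its remaining route while another vehicle still has to cross that area. *)

theory Defs
  imports "HOL-Analysis.Analysis"
begin

text \<open>
  Vehicles are numbered \<open>1..n\<close> and conflict areas \<open>1..m\<close>. For vehicle \<open>j\<close> the signal space is a
  topology on functions of time, whose underlying set is \<open>topspace (signals S j)\<close>; the values of a
  signal at negative times are irrelevant. The maps \<open>pos S j t u x v\<close> and \<open>speed S j t u x v\<close> are the
  position and the speed at time \<open>t\<close> from the initial state \<open>(x, v)\<close> under the input signal \<open>u\<close>.
  Conflict area \<open>i\<close> occupies the open interval from \<open>entry_pos S i j\<close> to \<open>exit_pos S i j\<close> of the path
  of vehicle \<open>j\<close>, provided that \<open>(i, j) \<in> route S\<close>.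
\<close>

record intersection_system =
  num_vehicles :: nat
  num_areas :: nat
  positions :: "nat \<Rightarrow> real set"
  vmin :: "nat \<Rightarrow> real"
  vmax :: "nat \<Rightarrow> real"
  umin :: "nat \<Rightarrow> real"
  umax :: "nat \<Rightarrow> real"
  accel :: "nat \<Rightarrow> real \<Rightarrow> real \<Rightarrow> real \<Rightarrow> real"
  signals :: "nat \<Rightarrow> (real \<Rightarrow> real) topology"
  pos :: "nat \<Rightarrow> real \<Rightarrow> (real \<Rightarrow> real) \<Rightarrow> real \<Rightarrow> real \<Rightarrow> real"
  speed :: "nat \<Rightarrow> real \<Rightarrow> (real \<Rightarrow> real) \<Rightarrow> real \<Rightarrow> real \<Rightarrow> real"
  route :: "(nat \<times> nat) set"
  entry_pos :: "nat \<Rightarrow> nat \<Rightarrow> real"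
  exit_pos :: "nat \<Rightarrow> nat \<Rightarrow> real"

definition vehicles :: "intersection_system \<Rightarrow> nat set" where
  "vehicles S = {1..num_vehicles S}"

definition speeds :: "intersection_system \<Rightarrow> nat \<Rightarrow> real set" where
  "speeds S j = {vmin S j..vmax S j}"

definition bounds_ok :: "intersection_system \<Rightarrow> bool" where
  "bounds_ok S \<longleftrightarrow> (\<forall>j\<in>vehicles S.
     0 < vmin S j \<and> vmin S j \<le> vmax S j \<and> umin S j \<le> umax S j \<and>
     (\<forall>u\<in>topspace (signals S j). \<forall>t\<ge>0. u t \<in> {umin S j..umax S j}))"

text \<open>
  Inputs need not be continuous in time, so the second-order equation is imposed in integrated form
  for the speed.
\<close>

definition dynamics_ok :: "intersection_system \<Rightarrow> bool" where
  "dynamics_ok S \<longleftrightarrow> (\<forall>j\<in>vehicles S. \<forall>u\<in>topspace (signals S j).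
     \<forall>x\<in>positions S j. \<forall>v\<in>speeds S j.
       pos S j 0 u x v = x \<and> speed S j 0 u x v = v \<and>
       (\<forall>t\<ge>0. pos S j t u x v \<in> positions S j \<and> speed S j t u x v \<in> speeds S j \<and>
          ((\<lambda>s. pos S j s u x v) has_real_derivative speed S j t u x v) (at t within {0..}) \<and>
          ((\<lambda>s. accel S j (pos S j s u x v) (speed S j s u x v) (u s))
             has_integral (speed S j t u x v - v)) {0..t}))"

definition continuous_dependence :: "intersection_system \<Rightarrow> bool" where
  "continuous_dependence S \<longleftrightarrow> (\<forall>j\<in>vehicles S.
     path_connected_space (signals S j) \<and>
     (\<forall>t\<ge>0. \<forall>x\<in>positions S j. \<forall>v\<in>speeds S j.
        continuous_map (signals S j) euclideanreal (\<lambda>u. pos S j t u x v)))"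

definition monotone_dependence :: "intersection_system \<Rightarrow> bool" where
  "monotone_dependence S \<longleftrightarrow> (\<forall>j\<in>vehicles S.
     \<forall>u\<in>topspace (signals S j). \<forall>u'\<in>topspace (signals S j).
     \<forall>x\<in>positions S j. \<forall>x'\<in>positions S j. \<forall>v\<in>speeds S j. \<forall>v'\<in>speeds S j. \<forall>t t'.
       (\<forall>s\<ge>0. u s \<le> u' s) \<and> x \<le> x' \<and> v \<le> v' \<and> 0 \<le> t \<and> t \<le> t' \<longrightarrow>
       pos S j t u x v \<le> pos S j t' u' x' v')"

definition areas_ok :: "intersection_system \<Rightarrow> bool" where
  "areas_ok S \<longleftrightarrow> route S \<subseteq> {1..num_areas S} \<times> vehicles S \<and>
     (\<forall>(i, j)\<in>route S. entry_pos S i j < exit_pos S i j) \<and>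
     (\<forall>i i' j. (i, j) \<in> route S \<and> (i', j) \<in> route S \<and> i \<noteq> i' \<longrightarrow>
        exit_pos S i j \<le> entry_pos S i' j \<or> exit_pos S i' j \<le> entry_pos S i j)"

definition intersection_model :: "intersection_system \<Rightarrow> bool" where
  "intersection_model S \<longleftrightarrow> bounds_ok S \<and> dynamics_ok S \<and>
     continuous_dependence S \<and> monotone_dependence S \<and> areas_ok S"

definition initial_condition ::
    "intersection_system \<Rightarrow> (nat \<Rightarrow> real) \<Rightarrow> (nat \<Rightarrow> real) \<Rightarrow> bool" where
  "initial_condition S x0 v0 \<longleftrightarrow>
     (\<forall>j\<in>vehicles S. x0 j \<in> positions S j \<and> v0 j \<in> speeds S j)"

definition ops :: "intersection_system \<Rightarrow> (nat \<Rightarrow> real) \<Rightarrow> (nat \<times> nat) set" where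
  "ops S x0 = {(i, j) \<in> route S. x0 j < exit_pos S i j}"

definition first_ops :: "intersection_system \<Rightarrow> (nat \<Rightarrow> real) \<Rightarrow> (nat \<times> nat) set" where
  "first_ops S x0 = {(i, j) \<in> ops S x0.
     \<forall>i'. (i', j) \<in> ops S x0 \<longrightarrow> entry_pos S i j \<le> entry_pos S i' j}"

definition last_ops :: "intersection_system \<Rightarrow> (nat \<Rightarrow> real) \<Rightarrow> (nat \<times> nat) set" where
  "last_ops S x0 = {(i, j) \<in> ops S x0.
     \<forall>i'. (i', j) \<in> ops S x0 \<longrightarrow> entry_pos S i' j \<le> entry_pos S i j}"

definition conj_arcs ::
    "intersection_system \<Rightarrow> (nat \<Rightarrow> real) \<Rightarrow> ((nat \<times> nat) \<times> (nat \<times> nat)) set" where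
  "conj_arcs S x0 = {((i, j), (i', j')). (i, j) \<in> ops S x0 \<and> (i', j') \<in> ops S x0 \<and> j = j' \<and>
     entry_pos S i j < entry_pos S i' j \<and>
     \<not> (\<exists>i''. (i'', j) \<in> ops S x0 \<and>
           entry_pos S i j < entry_pos S i'' j \<and> entry_pos S i'' j < entry_pos S i' j)}"

definition disj_arcs ::
    "intersection_system \<Rightarrow> (nat \<Rightarrow> real) \<Rightarrow> ((nat \<times> nat) \<times> (nat \<times> nat)) set" where
  "disj_arcs S x0 = {((i, j), (i', j')). (i, j) \<in> ops S x0 \<and> (i', j') \<in> ops S x0 \<and>
     i = i' \<and> j \<noteq> j'}"

text \<open>Used only outside \<open>first_ops\<close> and \<open>last_ops\<close>, respectively, where the arc is unique.\<close>

definition prev_area :: "intersection_system \<Rightarrow> (nat \<Rightarrow> real) \<Rightarrow> nat \<Rightarrow> nat \<Rightarrow> nat" where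
  "prev_area S x0 i j = (THE i'. ((i', j), (i, j)) \<in> conj_arcs S x0)"

definition next_area :: "intersection_system \<Rightarrow> (nat \<Rightarrow> real) \<Rightarrow> nat \<Rightarrow> nat \<Rightarrow> nat" where
  "next_area S x0 i j = (THE i'. ((i, j), (i', j)) \<in> conj_arcs S x0)"

definition passes :: "intersection_system \<Rightarrow> (nat \<Rightarrow> real) \<Rightarrow> (nat \<Rightarrow> real) \<Rightarrow>
    nat \<Rightarrow> (real \<Rightarrow> real) \<Rightarrow> real \<Rightarrow> real \<Rightarrow> bool" where
  "passes S x0 v0 j u t a \<longleftrightarrow> 0 \<le> t \<and> pos S j t u (x0 j) (v0 j) = a"

text \<open>
  The times at which vehicle \<open>j\<close> can be at position \<open>a\<close> under signals satisfying \<open>C\<close>. In \<open>ereal\<close> the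
  empty set has infimum \<open>\<infinity>\<close> and supremum \<open>-\<infinity>\<close>, which are the values prescribed for unsatisfiable
  constraints.
\<close>

definition times_at :: "intersection_system \<Rightarrow> (nat \<Rightarrow> real) \<Rightarrow> (nat \<Rightarrow> real) \<Rightarrow>
    nat \<Rightarrow> ((real \<Rightarrow> real) \<Rightarrow> bool) \<Rightarrow> real \<Rightarrow> ereal set" where
  "times_at S x0 v0 j C a =
     {ereal t | t u. u \<in> topspace (signals S j) \<and> C u \<and> passes S x0 v0 j u t a}"

text \<open>The jobshop scheduling problem.\<close>

definition release :: "intersection_system \<Rightarrow> (nat \<Rightarrow> real) \<Rightarrow> (nat \<Rightarrow> real) \<Rightarrow>
    (nat \<Rightarrow> nat \<Rightarrow> real) \<Rightarrow> nat \<Rightarrow> nat \<Rightarrow> ereal" where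
  "release S x0 v0 T i j =
     (if (i, j) \<in> first_ops S x0 then
        if x0 j < entry_pos S i j then Inf (times_at S x0 v0 j (\<lambda>u. True) (entry_pos S i j)) else 0
      else let i' = prev_area S x0 i j in
        Inf (times_at S x0 v0 j (\<lambda>u. passes S x0 v0 j u (T i' j) (entry_pos S i' j))
               (entry_pos S i j)))"

definition deadline :: "intersection_system \<Rightarrow> (nat \<Rightarrow> real) \<Rightarrow> (nat \<Rightarrow> real) \<Rightarrow>
    (nat \<Rightarrow> nat \<Rightarrow> real) \<Rightarrow> nat \<Rightarrow> nat \<Rightarrow> ereal" where
  "deadline S x0 v0 T i j =
     (if (i, j) \<in> first_ops S x0 then
        if x0 j < entry_pos S i j then Sup (times_at S x0 v0 j (\<lambda>u. True) (entry_pos S i j)) else 0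
      else let i' = prev_area S x0 i j in
        Sup (times_at S x0 v0 j (\<lambda>u. passes S x0 v0 j u (T i' j) (entry_pos S i' j))
               (entry_pos S i j)))"

definition process :: "intersection_system \<Rightarrow> (nat \<Rightarrow> real) \<Rightarrow> (nat \<Rightarrow> real) \<Rightarrow>
    (nat \<Rightarrow> nat \<Rightarrow> real) \<Rightarrow> nat \<Rightarrow> nat \<Rightarrow> ereal" where
  "process S x0 v0 T i j = Inf (times_at S x0 v0 j
     (\<lambda>u. (x0 j < entry_pos S i j \<longrightarrow> passes S x0 v0 j u (T i j) (entry_pos S i j)) \<and>
          ((i, j) \<notin> last_ops S x0 \<longrightarrow>
             (let i'' = next_area S x0 i j in
                passes S x0 v0 j u (T i'' j) (entry_pos S i'' j))))
     (exit_pos S i j))"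

definition jobshop_feasible :: "intersection_system \<Rightarrow> real \<Rightarrow> (nat \<Rightarrow> real) \<Rightarrow> (nat \<Rightarrow> real) \<Rightarrow>
    (nat \<Rightarrow> nat \<Rightarrow> real) \<Rightarrow> (nat \<Rightarrow> nat \<Rightarrow> nat \<Rightarrow> real) \<Rightarrow> bool" where
  "jobshop_feasible S M x0 v0 T k \<longleftrightarrow>
     (\<forall>(i, j)\<in>ops S x0. release S x0 v0 T i j \<le> ereal (T i j)) \<and>
     (\<forall>i j j'. ((i, j), (i, j')) \<in> disj_arcs S x0 \<longrightarrow>
        k i j j' \<in> {0, 1} \<and>
        process S x0 v0 T i j \<le> ereal (T i j' + M * (1 - k i j j')) \<and>
        process S x0 v0 T i j' \<le> ereal (T i j + M * (1 - k i j' j)) \<and>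
        k i j j' + k i j' j = 1)"

definition jobshop_cost :: "intersection_system \<Rightarrow> (nat \<Rightarrow> real) \<Rightarrow> (nat \<Rightarrow> real) \<Rightarrow>
    (nat \<Rightarrow> nat \<Rightarrow> real) \<Rightarrow> ereal" where
  "jobshop_cost S x0 v0 T =
     Max (insert 0 ((\<lambda>(i, j). ereal (T i j) - deadline S x0 v0 T i j) ` ops S x0))"

definition jobshop_value ::
    "intersection_system \<Rightarrow> real \<Rightarrow> (nat \<Rightarrow> real) \<Rightarrow> (nat \<Rightarrow> real) \<Rightarrow> ereal" where
  "jobshop_value S M x0 v0 =
     Inf {jobshop_cost S x0 v0 T | T k. jobshop_feasible S M x0 v0 T k}"

text \<open>The lower bound problem.\<close>

definition lb_release :: "intersection_system \<Rightarrow> (nat \<Rightarrow> real) \<Rightarrow> (nat \<Rightarrow> real) \<Rightarrow>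
    (nat \<Rightarrow> nat \<Rightarrow> real) \<Rightarrow> nat \<Rightarrow> nat \<Rightarrow> ereal" where
  "lb_release S x0 v0 p i j =
     (if (i, j) \<in> first_ops S x0 then
        if x0 j < entry_pos S i j then Inf (times_at S x0 v0 j (\<lambda>u. True) (entry_pos S i j)) else 0
      else let i' = prev_area S x0 i j in
        ereal (p i' j + (entry_pos S i j - exit_pos S i' j) / vmax S j))"

definition lb_deadline :: "intersection_system \<Rightarrow> (nat \<Rightarrow> real) \<Rightarrow> (nat \<Rightarrow> real) \<Rightarrow>
    (nat \<Rightarrow> nat \<Rightarrow> real) \<Rightarrow> nat \<Rightarrow> nat \<Rightarrow> ereal" where
  "lb_deadline S x0 v0 p i j =
     (if (i, j) \<in> first_ops S x0 then
        if x0 j < entry_pos S i j then Sup (times_at S x0 v0 j (\<lambda>u. True) (entry_pos S i j)) else 0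
      else let i' = prev_area S x0 i j in
        ereal (p i' j + (entry_pos S i j - exit_pos S i' j) / vmin S j))"

definition lb_feasible :: "intersection_system \<Rightarrow> real \<Rightarrow> (nat \<Rightarrow> real) \<Rightarrow> (nat \<Rightarrow> real) \<Rightarrow>
    (nat \<Rightarrow> nat \<Rightarrow> real) \<Rightarrow> (nat \<Rightarrow> nat \<Rightarrow> real) \<Rightarrow> (nat \<Rightarrow> nat \<Rightarrow> nat \<Rightarrow> real) \<Rightarrow> bool" where
  "lb_feasible S M x0 v0 t p k \<longleftrightarrow>
     (\<forall>(i, j)\<in>ops S x0.
        lb_release S x0 v0 p i j \<le> ereal (t i j) \<and> 0 \<le> p i j \<and>
        (exit_pos S i j - entry_pos S i j) / vmax S j \<le> p i j - t i j \<and>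
        p i j - t i j \<le> (exit_pos S i j - entry_pos S i j) / vmin S j) \<and>
     (\<forall>i j j'. ((i, j), (i, j')) \<in> disj_arcs S x0 \<longrightarrow>
        k i j j' \<in> {0, 1} \<and>
        p i j \<le> t i j' + M * (1 - k i j j') \<and>
        p i j' \<le> t i j + M * (1 - k i j' j) \<and>
        k i j j' + k i j' j = 1)"

definition lb_cost :: "intersection_system \<Rightarrow> (nat \<Rightarrow> real) \<Rightarrow> (nat \<Rightarrow> real) \<Rightarrow>
    (nat \<Rightarrow> nat \<Rightarrow> real) \<Rightarrow> (nat \<Rightarrow> nat \<Rightarrow> real) \<Rightarrow> ereal" where
  "lb_cost S x0 v0 t p =
     Max (insert 0 ((\<lambda>(i, j). ereal (t i j) - lb_deadline S x0 v0 p i j) ` ops S x0))"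

definition lb_value ::
    "intersection_system \<Rightarrow> real \<Rightarrow> (nat \<Rightarrow> real) \<Rightarrow> (nat \<Rightarrow> real) \<Rightarrow> ereal" where
  "lb_value S M x0 v0 =
     Inf {lb_cost S x0 v0 t p | t p k. lb_feasible S M x0 v0 t p k}"

text \<open>
  The constraint \<open>p - t \<ge> (exit - entry) / vmax\<close> of the lower bound problem charges a vehicle that
  starts inside a conflict area for the whole area, although only \<open>exit - x0\<close> is left to travel; and
  the process time of such a vehicle, if the area is its last one, does not depend on its scheduled
  time. For such initial conditions the lower bound can exceed the jobshop value: take two vehicles of
  constant speed 1 (\<open>accel = 0\<close>, \<open>vmin = 1\<close>, \<open>vmax = 2\<close>) with a single common area \<open>(0, 1)\<close>, the first
  starting at 9/10 and the second at -1/5. The jobshop value is 0 (\<open>T = (0, 1/5)\<close>), whereas the lower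
  bound problem delays the entry of the second vehicle to 1/2, or makes the first one wait for the
  second to exit, at a cost of at least 3/10. The following predicate excludes only vehicles
  that start inside their last remaining area while another vehicle still has to cross it.
\<close>

definition no_start_inside_shared_last :: "intersection_system \<Rightarrow> (nat \<Rightarrow> real) \<Rightarrow> bool" where
  "no_start_inside_shared_last S x0 \<longleftrightarrow>
     (\<forall>i j j'. (i, j) \<in> last_ops S x0 \<and> ((i, j), (i, j')) \<in> disj_arcs S x0 \<longrightarrow>
        x0 j < entry_pos S i j)"

end

theory Submission
  imports Defs
begin

text \<open>
  The speed bounds carry the proof: under any signal, covering a distance \<open>d\<close> takes between
  \<open>d / vmax\<close> and \<open>d / vmin\<close> (\<open>travel_time\<close>). A feasible schedule \<open>T\<close> with binary choices \<open>k\<close> is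
  turned into a feasible point of the lower bound problem of no larger cost by keeping \<open>t = T\<close> and
  \<open>k\<close> and choosing exit times \<open>p\<close>; these can be chosen one operation at a time, because each is
  constrained only by the entry time into its own area, by the entry time into the next area of the
  same vehicle, and, if the area is shared, by the requirement that it be at most the process time.

  If the process time is finite, it serves as exit time. It is an infimum of exit times along
  actual trajectories that pass both entries on schedule; every such exit time satisfies the
  first-order bounds, and these are closed conditions, so that the infimum satisfies them as well.
  The lateness of the next operation is then at most zero (\<open>exit_time_ok_process\<close>).

  If the process time is infinite, the area is not shared, since a sharing arc bounds the
  process time by a real number in either order. Then the exit may be as late as both
  the slowest crossing and the timely arrival at the next area permit. Either the exit
  is the slowest one, and the next deadline of the lower bound problem is no earlier than the true
  deadline; or the vehicle has to drive at full speed afterwards, and the next operation is not late (\<open>exit_time_ok_exists\<close>).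

  Initial positions inside an area need care, since the process time then ignores the scheduled entry
  time. If the vehicle has a further area to cross, the release time of that area is finite only
  when some trajectory passes the entry of the current area on schedule, which forces the vehicle to
  start exactly at that entry at time 0 (\<open>passes_if_start_beyond\<close>). Otherwise the area is the last
  one, and by hypothesis nobody else has to cross it.
\<close>

section \<open>The order of the areas on a path\<close>

lemma finite_ops:
  assumes "intersection_model S"
  shows "finite (ops S x0)"
proof (rule finite_subset)
  show "ops S x0 \<subseteq> {1..num_areas S} \<times> vehicles S"
    using assms by (auto simp: ops_def intersection_model_def areas_ok_def)
  show "finite ({1..num_areas S} \<times> vehicles S)"
    by (simp add: vehicles_def)
qed

lemma ops_vehicle: "j \<in> vehicles S" if "intersection_model S" "(i, j) \<in> ops S x0"
  using that by (auto simp: ops_def intersection_model_def areas_ok_def)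

lemma ops_entry_less_exit:
  "entry_pos S i j < exit_pos S i j" if "intersection_model S" "(i, j) \<in> ops S x0"
  using that by (auto simp: ops_def intersection_model_def areas_ok_def)

lemma ops_entry_inj:
  assumes "intersection_model S" "(i, j) \<in> ops S x0" "(i', j) \<in> ops S x0"
    and "entry_pos S i j = entry_pos S i' j"
  shows "i = i'"
proof (rule ccontr)
  assume "i \<noteq> i'"
  then have "exit_pos S i j \<le> entry_pos S i' j \<or> exit_pos S i' j \<le> entry_pos S i j"
    using assms(1-3) by (auto simp: ops_def intersection_model_def areas_ok_def)
  then show False
    using assms ops_entry_less_exit[OF assms(1,2)] ops_entry_less_exit[OF assms(1,3)] by auto
qed

lemma conj_arc_exit_le_entry:
  assumes "intersection_model S" "((i, j), (i', j)) \<in> conj_arcs S x0"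
  shows "exit_pos S i j \<le> entry_pos S i' j"
proof -
  have ops: "(i, j) \<in> ops S x0" "(i', j) \<in> ops S x0"
    and less: "entry_pos S i j < entry_pos S i' j"
    using assms(2) by (auto simp: conj_arcs_def)
  then have "i \<noteq> i'" by auto
  then have "exit_pos S i j \<le> entry_pos S i' j \<or> exit_pos S i' j \<le> entry_pos S i j"
    using assms(1) ops by (auto simp: ops_def intersection_model_def areas_ok_def)
  then show ?thesis
    using less ops_entry_less_exit[OF assms(1) ops(2)] by linarith
qed

lemma prev_area_eq:
  assumes "intersection_model S" "((i', j), (i, j)) \<in> conj_arcs S x0"
  shows "prev_area S x0 i j = i'"
  unfolding prev_area_def
proof (rule the_equality)
  show "((i', j), (i, j)) \<in> conj_arcs S x0" by (rule assms(2))
  fix i2 assume "((i2, j), (i, j)) \<in> conj_arcs S x0"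
  with assms(2) show "i2 = i'"
    by (intro ops_entry_inj[OF assms(1)]) (auto simp: conj_arcs_def intro: linorder_cases)
qed

lemma next_area_eq:
  assumes "intersection_model S" "((i, j), (i', j)) \<in> conj_arcs S x0"
  shows "next_area S x0 i j = i'"
  unfolding next_area_def
proof (rule the_equality)
  show "((i, j), (i', j)) \<in> conj_arcs S x0" by (rule assms(2))
  fix i2 assume "((i, j), (i2, j)) \<in> conj_arcs S x0"
  with assms(2) show "i2 = i'"
    by (intro ops_entry_inj[OF assms(1)]) (auto simp: conj_arcs_def intro: linorder_cases)
qed

lemma conj_arc_not_last: "((i, j), (i', j)) \<in> conj_arcs S x0 \<Longrightarrow> (i, j) \<notin> last_ops S x0"
  by (force simp: conj_arcs_def last_ops_def)

lemma conj_arc_not_first: "((i', j), (i, j)) \<in> conj_arcs S x0 \<Longrightarrow> (i, j) \<notin> first_ops S x0"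
  by (force simp: conj_arcs_def first_ops_def)

lemma finite_areas_of_vehicle:
  assumes "intersection_model S"
  shows "finite {i. (i, j) \<in> ops S x0 \<and> Q i}"
  by (rule finite_subset[OF _ finite_imageI[OF finite_ops[OF assms], where h = fst]]) force

lemma conj_arc_from_not_last:
  assumes model: "intersection_model S" and op: "(i, j) \<in> ops S x0"
    and not_last: "(i, j) \<notin> last_ops S x0"
  obtains i' where "((i, j), (i', j)) \<in> conj_arcs S x0"
proof -
  define A where "A = {i'. (i', j) \<in> ops S x0 \<and> entry_pos S i j < entry_pos S i' j}"
  have fin: "finite A" unfolding A_def by (rule finite_areas_of_vehicle[OF model])
  have "A \<noteq> {}" using op not_last by (force simp: A_def last_ops_def)
  then obtain i' where "i' \<in> A" "\<And>l. l \<in> A \<Longrightarrow> entry_pos S i' j \<le> entry_pos S l j"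
    using ex_is_arg_min_if_finite[OF fin, of "\<lambda>l. entry_pos S l j"]
    by (auto simp: is_arg_min_linorder)
  then have "((i, j), (i', j)) \<in> conj_arcs S x0"
    using op by (force simp: A_def conj_arcs_def)
  then show ?thesis by (rule that)
qed

lemma conj_arc_to_not_first:
  assumes model: "intersection_model S" and op: "(i, j) \<in> ops S x0"
    and not_first: "(i, j) \<notin> first_ops S x0"
  obtains i' where "((i', j), (i, j)) \<in> conj_arcs S x0"
proof -
  define A where "A = {i'. (i', j) \<in> ops S x0 \<and> entry_pos S i' j < entry_pos S i j}"
  have fin: "finite A" unfolding A_def by (rule finite_areas_of_vehicle[OF model])
  have "A \<noteq> {}" using op not_first by (force simp: A_def first_ops_def)
  then obtain i' where "i' \<in> A" "\<And>l. l \<in> A \<Longrightarrow> - entry_pos S i' j \<le> - entry_pos S l j"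
    using ex_is_arg_min_if_finite[OF fin, of "\<lambda>l. - entry_pos S l j"]
    by (auto simp: is_arg_min_linorder)
  then have "((i', j), (i, j)) \<in> conj_arcs S x0"
    using op by (force simp: A_def conj_arcs_def)
  then show ?thesis by (rule that)
qed

section \<open>Travel times\<close>

lemma displacement_bounds:
  assumes model: "intersection_model S" and init: "initial_condition S x0 v0"
    and j: "j \<in> vehicles S" and u: "u \<in> topspace (signals S j)" and st: "0 \<le> s" "s \<le> t"
  shows "vmin S j * (t - s) \<le> pos S j t u (x0 j) (v0 j) - pos S j s u (x0 j) (v0 j)"
    and "pos S j t u (x0 j) (v0 j) - pos S j s u (x0 j) (v0 j) \<le> vmax S j * (t - s)"
proof -
  let ?x = "\<lambda>s. pos S j s u (x0 j) (v0 j)" and ?v = "\<lambda>s. speed S j s u (x0 j) (v0 j)"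
  have dyn: "vmin S j \<le> ?v r" "?v r \<le> vmax S j" "(?x has_real_derivative ?v r) (at r within {0..})"
    if "0 \<le> r" for r
    using model init j u that
    by (auto simp: intersection_model_def dynamics_ok_def initial_condition_def speeds_def)
  have "vmin S j * (t - s) \<le> ?x t - ?x s \<and> ?x t - ?x s \<le> vmax S j * (t - s)"
  proof (cases "s = t")
    case False
    then have less: "s < t" using st by simp
    have "\<exists>r\<in>{s<..<t}. ?x t - ?x s = (t - s) * ?v r"
    proof (rule mvt_simple[OF less, where f = ?x and f' = "\<lambda>r h. h * ?v r", simplified])
      fix r assume "s \<le> r" "r \<le> t"
      then show "(?x has_derivative (\<lambda>h. h * ?v r)) (at r within {s..t})"
        using DERIV_subset[OF dyn(3), of r "{s..t}"] st
        by (auto simp: has_field_derivative_def mult_commute_abs)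
    qed
    then obtain r where r: "s < r" and eq: "?x t - ?x s = (t - s) * ?v r" by auto
    have "0 \<le> r" using r st by simp
    then show ?thesis
      unfolding eq using less dyn(1,2)[of r] by (simp add: mult.commute)
  qed simp
  then show "vmin S j * (t - s) \<le> ?x t - ?x s" "?x t - ?x s \<le> vmax S j * (t - s)" by auto
qed

lemma travel_time:
  assumes model: "intersection_model S" and init: "initial_condition S x0 v0"
    and j: "j \<in> vehicles S" and u: "u \<in> topspace (signals S j)"
    and a: "passes S x0 v0 j u s a" and b: "passes S x0 v0 j u t b" and ab: "a \<le> b"
  shows "(b - a) / vmax S j \<le> t - s" and "t - s \<le> (b - a) / vmin S j"
proof -
  have v: "0 < vmin S j" "0 < vmax S j"
    using model j by (force simp: intersection_model_def bounds_ok_def)+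
  have "s \<le> t"
  proof (rule ccontr)
    assume "\<not> s \<le> t"
    then have "0 < vmin S j * (s - t)" using v by simp
    also have "\<dots> \<le> a - b"
      using displacement_bounds(1)[OF model init j u, of t s] a b \<open>\<not> s \<le> t\<close>
      by (simp add: passes_def)
    finally show False using ab by simp
  qed
  then show "(b - a) / vmax S j \<le> t - s" "t - s \<le> (b - a) / vmin S j"
    using displacement_bounds[OF model init j u, of s t] a b v
    by (auto simp: passes_def field_simps)
qed

text \<open>
  Vehicles never move backwards, so a position at or behind the start can be passed only
  at the start and at time 0, which every signal does.
\<close>

lemma passes_if_start_beyond:
  assumes model: "intersection_model S" and init: "initial_condition S x0 v0"
    and j: "j \<in> vehicles S" and u: "u \<in> topspace (signals S j)"
    and w: "w \<in> topspace (signals S j)"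
    and a: "a \<le> x0 j" and pw: "passes S x0 v0 j w s a"
  shows "passes S x0 v0 j u s a"
proof -
  have start: "passes S x0 v0 j y 0 (x0 j)" if "y \<in> topspace (signals S j)" for y
    using model init j that
    by (auto simp: passes_def intersection_model_def dynamics_ok_def initial_condition_def)
  have "0 \<le> (x0 j - a) / vmax S j"
    using model j a by (force simp: intersection_model_def bounds_ok_def)
  with travel_time(1)[OF model init j w pw start[OF w] a] pw have "s = 0"
    by (simp add: passes_def)
  with pw start[OF w] have "a = x0 j" by (simp add: passes_def)
  with \<open>s = 0\<close> start[OF u] show ?thesis by simp
qed

lemma times_at_nonneg: "t \<in> times_at S x0 v0 j C a \<Longrightarrow> 0 \<le> t"
  by (auto simp: times_at_def passes_def)

lemma release_nonneg: "0 \<le> release S x0 v0 T i j"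
  by (auto simp: release_def Let_def intro!: Inf_greatest dest: times_at_nonneg)

section \<open>Exit times for a schedule\<close>

text \<open>
  The extrema that define release time and deadline range over trajectories that pass both entries,
  so that travel times bound them. Since a release time is finite only if such a trajectory exists,
  the scheduled entry into the earlier area is attainable, whatever the initial position.
\<close>

lemma conj_arc_schedule:
  assumes model: "intersection_model S" and init: "initial_condition S x0 v0"
    and arc: "((i, j), (i', j)) \<in> conj_arcs S x0"
    and rel: "release S x0 v0 T i' j \<le> ereal (T i' j)"
  shows "T i j + (entry_pos S i' j - entry_pos S i j) / vmax S j \<le> T i' j"
    and "deadline S x0 v0 T i' j \<le> ereal (T i j + (entry_pos S i' j - entry_pos S i j) / vmin S j)"
    and "\<exists>u\<in>topspace (signals S j). passes S x0 v0 j u (T i j) (entry_pos S i j)"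
proof -
  define A where "A = times_at S x0 v0 j (\<lambda>u. passes S x0 v0 j u (T i j) (entry_pos S i j))
    (entry_pos S i' j)"
  have j: "j \<in> vehicles S" and le: "entry_pos S i j \<le> entry_pos S i' j"
    using arc ops_vehicle[OF model] by (auto simp: conj_arcs_def)
  have rel_eq: "release S x0 v0 T i' j = Inf A" and dl_eq: "deadline S x0 v0 T i' j = Sup A"
    using conj_arc_not_first[OF arc] prev_area_eq[OF model arc]
    by (auto simp: release_def deadline_def A_def Let_def)
  have bounds: "ereal (T i j + (entry_pos S i' j - entry_pos S i j) / vmax S j) \<le> y \<and>
      y \<le> ereal (T i j + (entry_pos S i' j - entry_pos S i j) / vmin S j)" if yA: "y \<in> A" for y
  proof -
    obtain t u where y: "y = ereal t" "u \<in> topspace (signals S j)"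
        "passes S x0 v0 j u (T i j) (entry_pos S i j)" "passes S x0 v0 j u t (entry_pos S i' j)"
      using yA by (auto simp: A_def times_at_def)
    show ?thesis
      using travel_time[OF model init j y(2-4) le] y(1) by auto
  qed
  have "ereal (T i j + (entry_pos S i' j - entry_pos S i j) / vmax S j) \<le> Inf A"
    using bounds by (auto intro: Inf_greatest)
  then show "T i j + (entry_pos S i' j - entry_pos S i j) / vmax S j \<le> T i' j"
    using rel unfolding rel_eq by (metis ereal_less_eq(3) order_trans)
  show "deadline S x0 v0 T i' j \<le> ereal (T i j + (entry_pos S i' j - entry_pos S i j) / vmin S j)"
    unfolding dl_eq using bounds by (auto intro: Sup_least)
  have "A \<noteq> {}" using rel unfolding rel_eq by (auto simp: top_ereal_def)
  then show "\<exists>u\<in>topspace (signals S j). passes S x0 v0 j u (T i j) (entry_pos S i j)"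
    by (auto simp: A_def times_at_def)
qed

text \<open>
  The conditions that the lower bound problem puts on one exit time \<open>q\<close> when the entry times are kept,
  apart from the sharing of areas. In the last conjunct the lateness of the next operation may
  grow up to 0 because the cost is a maximum that includes 0.
\<close>

definition exit_time_ok where
  "exit_time_ok S x0 v0 T i j q \<longleftrightarrow>
     (exit_pos S i j - entry_pos S i j) / vmax S j \<le> q - T i j \<and>
     q - T i j \<le> (exit_pos S i j - entry_pos S i j) / vmin S j \<and>
     (\<forall>i'. ((i, j), (i', j)) \<in> conj_arcs S x0 \<longrightarrow>
        q + (entry_pos S i' j - exit_pos S i j) / vmax S j \<le> T i' j \<and>
        ereal (T i' j - (q + (entry_pos S i' j - exit_pos S i j) / vmin S j))
          \<le> max 0 (ereal (T i' j) - deadline S x0 v0 T i' j))"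

text \<open>
  The process time is compared with the first-order bounds through the set \<open>A\<close> of the exit times of
  which it is the infimum: upper bounds need one member of \<open>A\<close>, lower bounds need all of them.
\<close>

lemma exit_time_ok_process:
  assumes model: "intersection_model S" and init: "initial_condition S x0 v0"
    and op: "(i, j) \<in> ops S x0"
    and rel: "\<forall>(i, j)\<in>ops S x0. release S x0 v0 T i j \<le> ereal (T i j)"
    and fin: "process S x0 v0 T i j < \<infinity>"
    and outside: "(i, j) \<in> last_ops S x0 \<Longrightarrow> x0 j < entry_pos S i j"
  shows "\<exists>q. ereal q = process S x0 v0 T i j \<and> exit_time_ok S x0 v0 T i j q"
proof -
  let ?a = "entry_pos S i j" and ?b = "exit_pos S i j"
  define A where "A = times_at S x0 v0 j
     (\<lambda>u. (x0 j < entry_pos S i j \<longrightarrow> passes S x0 v0 j u (T i j) (entry_pos S i j)) \<and>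
          ((i, j) \<notin> last_ops S x0 \<longrightarrow>
             (let i'' = next_area S x0 i j in
                passes S x0 v0 j u (T i'' j) (entry_pos S i'' j))))
     (exit_pos S i j)"
  have P: "process S x0 v0 T i j = Inf A" by (simp add: process_def A_def)
  have j: "j \<in> vehicles S" using ops_vehicle[OF model op] .
  have ab: "?a \<le> ?b" using ops_entry_less_exit[OF model op] by simp
  have rel': "release S x0 v0 T i' j \<le> ereal (T i' j)"
    if "((i, j), (i', j)) \<in> conj_arcs S x0" for i'
    using rel that by (auto simp: conj_arcs_def)
  have entry: "passes S x0 v0 j u (T i j) ?a"
    if u: "u \<in> topspace (signals S j)" and "x0 j < ?a \<longrightarrow> passes S x0 v0 j u (T i j) ?a" for u
  proof (cases "x0 j < ?a")
    case False
    then obtain i' where arc: "((i, j), (i', j)) \<in> conj_arcs S x0"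
      using outside conj_arc_from_not_last[OF model op] by blast
    obtain w where "w \<in> topspace (signals S j)" "passes S x0 v0 j w (T i j) ?a"
      using conj_arc_schedule(3)[OF model init arc rel'[OF arc]] by blast
    with False show ?thesis
      using passes_if_start_beyond[OF model init j u] by simp
  qed (use that in simp)
  have bounds: "\<exists>e. y = ereal e \<and> 0 \<le> e \<and>
      (?b - ?a) / vmax S j \<le> e - T i j \<and> e - T i j \<le> (?b - ?a) / vmin S j \<and>
      (\<forall>i'. ((i, j), (i', j)) \<in> conj_arcs S x0 \<longrightarrow>
        (entry_pos S i' j - ?b) / vmax S j \<le> T i' j - e \<and>
        T i' j - e \<le> (entry_pos S i' j - ?b) / vmin S j)" if yA: "y \<in> A" for y
  proof -
    obtain e u where y: "y = ereal e" and u: "u \<in> topspace (signals S j)"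
        and e: "passes S x0 v0 j u e ?b" and a: "passes S x0 v0 j u (T i j) ?a"
        and nxt: "(i, j) \<notin> last_ops S x0 \<longrightarrow> passes S x0 v0 j u
          (T (next_area S x0 i j) j) (entry_pos S (next_area S x0 i j) j)"
      using yA entry by (auto simp: A_def times_at_def Let_def)
    have "(entry_pos S i' j - ?b) / vmax S j \<le> T i' j - e \<and>
        T i' j - e \<le> (entry_pos S i' j - ?b) / vmin S j"
      if arc: "((i, j), (i', j)) \<in> conj_arcs S x0" for i'
    proof -
      have "passes S x0 v0 j u (T i' j) (entry_pos S i' j)"
        using nxt conj_arc_not_last[OF arc] next_area_eq[OF model arc] by simp
      from travel_time[OF model init j u e this conj_arc_exit_le_entry[OF model arc]]
      show ?thesis by simp
    qed
    moreover have "0 \<le> e" using e by (simp add: passes_def)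
    ultimately show ?thesis
      using y travel_time[OF model init j u a e ab] by blast
  qed
  have ne: "A \<noteq> {}" using fin unfolding P by (auto simp: top_ereal_def)
  then obtain y where y: "y \<in> A" by blast
  then have "0 \<le> Inf A" by (auto intro!: Inf_greatest dest!: bounds)
  with fin obtain q where q: "Inf A = ereal q" unfolding P by (cases "Inf A") auto
  have upper: "q \<le> e" if "ereal e \<in> A" for e
    using Inf_lower[OF that] unfolding q by simp
  have lower: "c \<le> q" if "\<And>e. ereal e \<in> A \<Longrightarrow> c \<le> e" for c
  proof -
    have "ereal c \<le> Inf A"
    proof (rule Inf_greatest)
      fix y assume "y \<in> A"
      with bounds that show "ereal c \<le> y" by fastforce
    qed
    then show ?thesis unfolding q by simp
  qed
  obtain e where e: "ereal e \<in> A" using y bounds by blast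
  have "(?b - ?a) / vmax S j + T i j \<le> q"
    by (rule lower) (use bounds in fastforce)
  moreover have "q - T i j \<le> (?b - ?a) / vmin S j"
    using upper[OF e] bounds[OF e] by simp
  moreover have "q + (entry_pos S i' j - ?b) / vmax S j \<le> T i' j \<and>
      T i' j - (q + (entry_pos S i' j - ?b) / vmin S j) \<le> 0"
    if arc: "((i, j), (i', j)) \<in> conj_arcs S x0" for i'
  proof
    have "(entry_pos S i' j - ?b) / vmax S j \<le> T i' j - e" using bounds[OF e] arc by blast
    then show "q + (entry_pos S i' j - ?b) / vmax S j \<le> T i' j" using upper[OF e] by simp
    have "T i' j - (entry_pos S i' j - ?b) / vmin S j \<le> q"
      by (rule lower) (use bounds arc in fastforce)
    then show "T i' j - (q + (entry_pos S i' j - ?b) / vmin S j) \<le> 0" by simp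
  qed
  ultimately have "exit_time_ok S x0 v0 T i j q"
    unfolding exit_time_ok_def by (auto simp: max.coboundedI1 zero_ereal_def)
  with q P show ?thesis by auto
qed

lemma exit_time_ok_exists:
  assumes model: "intersection_model S" and init: "initial_condition S x0 v0"
    and op: "(i, j) \<in> ops S x0"
    and rel: "\<forall>(i, j)\<in>ops S x0. release S x0 v0 T i j \<le> ereal (T i j)"
  shows "\<exists>q. exit_time_ok S x0 v0 T i j q"
proof -
  let ?a = "entry_pos S i j" and ?b = "exit_pos S i j"
  have ab: "?a < ?b" using ops_entry_less_exit[OF model op] .
  have v: "0 < vmin S j" "vmin S j \<le> vmax S j"
    using model ops_vehicle[OF model op] by (auto simp: intersection_model_def bounds_ok_def)
  have slower: "d / vmax S j \<le> d / vmin S j" if "0 \<le> d" for d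
    using v that by (intro divide_left_mono) auto
  show ?thesis
  proof (cases "\<exists>i'. ((i, j), (i', j)) \<in> conj_arcs S x0")
    case False
    then have "exit_time_ok S x0 v0 T i j (T i j + (?b - ?a) / vmax S j)"
      using slower[of "?b - ?a"] ab by (simp add: exit_time_ok_def)
    then show ?thesis ..
  next
    case True
    then obtain i' where arc: "((i, j), (i', j)) \<in> conj_arcs S x0" ..
    let ?c = "entry_pos S i' j"
    have uniq: "i2 = i'" if "((i, j), (i2, j)) \<in> conj_arcs S x0" for i2
      using next_area_eq[OF model that] next_area_eq[OF model arc] by simp
    have bc: "?b \<le> ?c" using conj_arc_exit_le_entry[OF model arc] .
    have rel': "release S x0 v0 T i' j \<le> ereal (T i' j)"
      using rel arc by (auto simp: conj_arcs_def)
    note sched = conj_arc_schedule[OF model init arc rel']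
    have split: "(?c - ?a) / w = (?b - ?a) / w + (?c - ?b) / w" for w :: real
      by (simp add: diff_divide_distrib)
    \<comment> \<open>The latest exit compatible with the minimal speed inside the area and the maximal speed after it.\<close>
    define q where "q = min (T i j + (?b - ?a) / vmin S j) (T i' j - (?c - ?b) / vmax S j)"
    have "ereal (T i' j - (q + (?c - ?b) / vmin S j))
        \<le> max 0 (ereal (T i' j) - deadline S x0 v0 T i' j)"
    proof (cases "q = T i j + (?b - ?a) / vmin S j")
      case True
      then have "ereal (T i' j - (q + (?c - ?b) / vmin S j)) =
          ereal (T i' j) - ereal (T i j + (?c - ?a) / vmin S j)"
        by (simp add: split)
      also have "\<dots> \<le> ereal (T i' j) - deadline S x0 v0 T i' j"
        using sched(2) by (intro ereal_minus_mono) auto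
      finally show ?thesis by (simp add: max.coboundedI2)
    next
      case False
      then have "q = T i' j - (?c - ?b) / vmax S j" by (auto simp: q_def min_def split: if_splits)
      then have "T i' j - (q + (?c - ?b) / vmin S j) \<le> 0"
        using slower[of "?c - ?b"] bc by simp
      then show ?thesis by (intro max.coboundedI1) (simp add: zero_ereal_def)
    qed
    moreover have "(?b - ?a) / vmax S j \<le> q - T i j"
      using slower[of "?b - ?a"] ab sched(1) by (simp add: q_def split)
    moreover have "q - T i j \<le> (?b - ?a) / vmin S j" "q + (?c - ?b) / vmax S j \<le> T i' j"
      by (auto simp: q_def min_def)
    ultimately have "exit_time_ok S x0 v0 T i j q"
      unfolding exit_time_ok_def using uniq by blast
    then show ?thesis ..
  qed
qed

section \<open>Comparison of the two optimal values\<close>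

lemma lb_cost_le_jobshop_cost:
  assumes model: "intersection_model S"
    and ok: "\<And>i j. (i, j) \<in> ops S x0 \<Longrightarrow> exit_time_ok S x0 v0 T i j (p i j)"
  shows "lb_cost S x0 v0 T p \<le> jobshop_cost S x0 v0 T"
proof -
  let ?J = "jobshop_cost S x0 v0 T"
  note fin = finite_ops[OF model, of x0]
  have J0: "0 \<le> ?J" unfolding jobshop_cost_def using fin by (intro Max_ge) auto
  have J: "ereal (T i j) - deadline S x0 v0 T i j \<le> ?J" if "(i, j) \<in> ops S x0" for i j
    unfolding jobshop_cost_def using fin that by (intro Max_ge) force+
  have "ereal (T i j) - lb_deadline S x0 v0 p i j \<le> ?J" if op: "(i, j) \<in> ops S x0" for i j
  proof (cases "(i, j) \<in> first_ops S x0")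
    case True
    then show ?thesis using J[OF op] by (simp add: lb_deadline_def deadline_def)
  next
    case False
    then obtain i' where arc: "((i', j), (i, j)) \<in> conj_arcs S x0"
      using conj_arc_to_not_first[OF model op] by blast
    then have "exit_time_ok S x0 v0 T i' j (p i' j)"
      using ok by (auto simp: conj_arcs_def)
    then have "ereal (T i j - (p i' j + (entry_pos S i j - exit_pos S i' j) / vmin S j))
        \<le> max 0 (ereal (T i j) - deadline S x0 v0 T i j)"
      using arc unfolding exit_time_ok_def by blast
    also have "\<dots> \<le> ?J" using J0 J[OF op] by simp
    finally show ?thesis
      using False prev_area_eq[OF model arc] by (simp add: lb_deadline_def Let_def)
  qed
  then show ?thesis
    unfolding lb_cost_def using fin J0 by (subst Max_le_iff) auto
qed

lemma lb_feasible_of_exit_times: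
  assumes model: "intersection_model S"
    and feas: "jobshop_feasible S M x0 v0 T k"
    and ok: "\<And>i j. (i, j) \<in> ops S x0 \<Longrightarrow> exit_time_ok S x0 v0 T i j (p i j)"
    and shared: "\<And>i j j'. ((i, j), (i, j')) \<in> disj_arcs S x0 \<Longrightarrow>
      ereal (p i j) \<le> process S x0 v0 T i j"
  shows "lb_feasible S M x0 v0 T p k"
proof -
  have rel: "release S x0 v0 T i j \<le> ereal (T i j)" if "(i, j) \<in> ops S x0" for i j
    using feas that by (auto simp: jobshop_feasible_def)
  have "lb_release S x0 v0 p i j \<le> ereal (T i j)" if op: "(i, j) \<in> ops S x0" for i j
  proof (cases "(i, j) \<in> first_ops S x0")
    case True
    then show ?thesis using rel[OF op] by (simp add: lb_release_def release_def)
  next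
    case False
    then obtain i' where arc: "((i', j), (i, j)) \<in> conj_arcs S x0"
      using conj_arc_to_not_first[OF model op] by blast
    then have "exit_time_ok S x0 v0 T i' j (p i' j)"
      using ok by (auto simp: conj_arcs_def)
    then show ?thesis
      using arc False prev_area_eq[OF model arc]
      by (auto simp: exit_time_ok_def lb_release_def Let_def)
  qed
  moreover have "0 \<le> p i j" if op: "(i, j) \<in> ops S x0" for i j
  proof -
    have "0 \<le> ereal (T i j)" using rel[OF op] release_nonneg order_trans by blast
    moreover have "0 \<le> (exit_pos S i j - entry_pos S i j) / vmax S j"
      using model ops_vehicle[OF model op] ops_entry_less_exit[OF model op]
      by (force simp: intersection_model_def bounds_ok_def)
    ultimately show ?thesis using ok[OF op] by (simp add: exit_time_ok_def)
  qed
  moreover have "k i j j' \<in> {0, 1} \<and> p i j \<le> T i j' + M * (1 - k i j j') \<and>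
      p i j' \<le> T i j + M * (1 - k i j' j) \<and> k i j j' + k i j' j = 1"
    if arc: "((i, j), (i, j')) \<in> disj_arcs S x0" for i j j'
  proof -
    have sym: "((i, j'), (i, j)) \<in> disj_arcs S x0" using arc by (auto simp: disj_arcs_def)
    have k: "k i j j' \<in> {0, 1}" "k i j j' + k i j' j = 1"
      and P: "process S x0 v0 T i j \<le> ereal (T i j' + M * (1 - k i j j'))"
        "process S x0 v0 T i j' \<le> ereal (T i j + M * (1 - k i j' j))"
      using feas arc by (auto simp: jobshop_feasible_def)
    show ?thesis
      using k order_trans[OF shared[OF arc] P(1)] order_trans[OF shared[OF sym] P(2)] by simp
  qed
  ultimately show ?thesis
    using ok by (auto simp: lb_feasible_def exit_time_ok_def)
qed

theorem theorem2:
  fixes S :: intersection_system and M :: real and x0 v0 :: "nat \<Rightarrow> real"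
  assumes "intersection_model S"
    and "0 < M"
    and "initial_condition S x0 v0"
    and "no_start_inside_shared_last S x0"
  shows "lb_value S M x0 v0 \<le> jobshop_value S M x0 v0"
  unfolding jobshop_value_def
proof (rule Inf_greatest, clarify)
  fix T k assume feas: "jobshop_feasible S M x0 v0 T k"
  note model = assms(1) and init = assms(3)
  have rel: "\<forall>(i, j)\<in>ops S x0. release S x0 v0 T i j \<le> ereal (T i j)"
    using feas by (simp add: jobshop_feasible_def)
  have "\<exists>q. (i, j) \<in> ops S x0 \<longrightarrow> exit_time_ok S x0 v0 T i j q \<and>
      ((\<exists>j'. ((i, j), (i, j')) \<in> disj_arcs S x0) \<longrightarrow> ereal q \<le> process S x0 v0 T i j)" for i j
  proof (cases "\<exists>j'. ((i, j), (i, j')) \<in> disj_arcs S x0")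
    case True
    then obtain j' where arc: "((i, j), (i, j')) \<in> disj_arcs S x0" ..
    have "process S x0 v0 T i j \<le> ereal (T i j' + M * (1 - k i j j'))"
      using feas arc by (simp add: jobshop_feasible_def)
    then have "process S x0 v0 T i j < \<infinity>" by auto
    moreover have "(i, j) \<in> last_ops S x0 \<Longrightarrow> x0 j < entry_pos S i j"
      using assms(4) arc by (auto simp: no_start_inside_shared_last_def)
    moreover have "(i, j) \<in> ops S x0" using arc by (auto simp: disj_arcs_def)
    ultimately show ?thesis
      using exit_time_ok_process[OF model init _ rel, of i j] by force
  next
    case False
    then show ?thesis using exit_time_ok_exists[OF model init _ rel, of i j] by blast
  qed
  then obtain p where p: "\<And>i j. (i, j) \<in> ops S x0 \<Longrightarrow> exit_time_ok S x0 v0 T i j (p i j)"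
    "\<And>i j j'. (i, j) \<in> ops S x0 \<Longrightarrow> ((i, j), (i, j')) \<in> disj_arcs S x0 \<Longrightarrow>
      ereal (p i j) \<le> process S x0 v0 T i j"
    by metis
  have "lb_feasible S M x0 v0 T p k"
    by (rule lb_feasible_of_exit_times[OF model feas p(1)])
      (use p(2) in \<open>auto simp: disj_arcs_def\<close>)
  then have "lb_value S M x0 v0 \<le> lb_cost S x0 v0 T p"
    unfolding lb_value_def by (intro Inf_lower) blast
  also have "\<dots> \<le> jobshop_cost S x0 v0 T"
    by (rule lb_cost_le_jobshop_cost[OF model p(1)])
  finally show "lb_value S M x0 v0 \<le> jobshop_cost S x0 v0 T" .
qed

end
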